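(* For all integers $r\geq 4$ and $n\geq r$, we have $f_c(n,r)\leq f(n,r)+2\sqrt{n}+1$.
   Context: All graphs are finite and simple. An edge-colored graph is a graph with a color assigned to each edge (the coloring need not be proper). For a vertex $v$ of an edge-colored graph $G$, the color degree $d^c_G(v)$ is the number of distinct colors on edges incident to $v$, and $\delta^c(G)=\min_{v\in V(G)} d^c_G(v)$. A subgraph is properly colored if any two adjacent edges of it have different colors. For positive integers $n\ge r$, $f(n,r)$ denotes the least integer such that every digraph $D$ on $n$ vertices with minimum out-degree $\delta^+(D)\geq f(n,r)$ contains a directed cycle of length at most $r$. For $n\geq r\geq 3$, $f_c(n,r)$ denotes the least integer such that every edge-colored graph $G$ on $n$ vertices with $\delta^c(G)\geq f_c(n,r)$ contains a properly colored cycle of length at most $r$. *)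

theory Defs
  imports Complex_Main "Graph_Theory.Graph_Theory"
begin

text \<open>
  A finite simple digraph is a \<open>pair_digraph\<close> (no loops, no parallel arcs; the two arcs
  \<open>(u,v)\<close> and \<open>(v,u)\<close> may both be present and then form a directed cycle of length 2).
  A finite simple graph is a \<open>pair_graph\<close>, i.e. a \<open>pair_digraph\<close> whose arc relation is symmetric;
  the two arcs \<open>(u,v)\<close> and \<open>(v,u)\<close> together represent the single edge \<open>{u,v}\<close>.
  An edge coloring is a function on edges, hence automatically independent of the orientation;
  its values on sets that are not edges are irrelevant.
\<close>

definition min_out_degree :: "('a,'b) pre_digraph \<Rightarrow> nat" where
  "min_out_degree D = Min (out_degree D ` verts D)"

definition edges_of :: "('a \<times> 'a) set \<Rightarrow> 'a set set" where
  "edges_of A = (\<lambda>(u,v). {u,v}) ` A"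

definition color_degree :: "'a pair_pre_digraph \<Rightarrow> ('a set \<Rightarrow> 'c) \<Rightarrow> 'a \<Rightarrow> nat" where
  "color_degree G c v = card (c ` {e \<in> edges_of (parcs G). v \<in> e})"

definition min_color_degree :: "'a pair_pre_digraph \<Rightarrow> ('a set \<Rightarrow> 'c) \<Rightarrow> nat" where
  "min_color_degree G c = Min (color_degree G c ` pverts G)"

definition properly_colored :: "('a set \<Rightarrow> 'c) \<Rightarrow> 'a set set \<Rightarrow> bool" where
  "properly_colored c F \<longleftrightarrow>
     (\<forall>e\<in>F. \<forall>e'\<in>F. e \<noteq> e' \<and> e \<inter> e' \<noteq> {} \<longrightarrow> c e \<noteq> c e')"

text \<open>
  A cycle is given by its list of arcs, so its length is the length of the list. In a symmetric
  digraph the closed walk \<open>[(u,v), (v,u)]\<close> satisfies the predicate \<open>cycle\<close>, although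
  it is not a cycle of the undirected graph; hence the condition \<open>3 \<le> length p\<close>.
\<close>

definition graph_cycle :: "'a pair_pre_digraph \<Rightarrow> ('a \<times> 'a) list \<Rightarrow> bool" where
  "graph_cycle G p \<longleftrightarrow> pre_digraph.cycle (with_proj G) p \<and> 3 \<le> length p"

text \<open>
  Vertices and colors are natural numbers, which is no restriction for finite graphs. In the
  relevant ranges of \<open>n\<close> and \<open>r\<close>, the bound \<open>k = n\<close> satisfies each of the two conditions vacuously
  and \<open>k = 0\<close> violates them because of the edgeless graph, so the least natural number is the
  least integer.
\<close>

definition f_d :: "nat \<Rightarrow> nat \<Rightarrow> nat" where
  "f_d n r = (LEAST k. \<forall>D :: nat pair_pre_digraph.
     pair_digraph D \<and> card (pverts D) = n \<and> k \<le> min_out_degree (with_proj D) \<longrightarrow>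
       (\<exists>p. pre_digraph.cycle (with_proj D) p \<and> length p \<le> r))"

definition f_c :: "nat \<Rightarrow> nat \<Rightarrow> nat" where
  "f_c n r = (LEAST k. \<forall>(G :: nat pair_pre_digraph) (c :: nat set \<Rightarrow> nat).
     pair_graph G \<and> card (pverts G) = n \<and> k \<le> min_color_degree G c \<longrightarrow>
       (\<exists>p. graph_cycle G p \<and> properly_colored c (edges_of (set p)) \<and> length p \<le> r))"

end

theory Submission
  imports Defs
begin

text \<open>
  Suppose that \<open>G\<close> has no properly colored cycle of length at most \<open>r\<close>. Delete edges as long as
  no vertex loses a color; what remains of each color is a disjoint union of stars. Orienting the
  stars from leaf to center costs every vertex \<open>b\<close> only the colors of the stars centered
  at \<open>b\<close>. Let \<open>N b\<close> contain one leaf of each of them. As \<open>r \<ge> 4\<close>, there is no properly colored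
  4-cycle, so two sets \<open>N b\<close> share at most one vertex, and hence only few of them are large.
  At the set \<open>B\<close> of vertices with large \<open>N b\<close>, instead let the center point to the leaves
  in \<open>N b\<close> and drop the other edges of these stars; this costs every vertex at most \<open>card B\<close>
  further out-arcs. Consecutive arcs of the resulting digraph have distinct
  colors, so its directed cycles are properly colored cycles of \<open>G\<close>, and each out-degree is less
  than the color degree by at most \<open>2 * sqrt n + 1\<close>.
\<close>

section \<open>Counting large sets with small pairwise intersections\<close>

text \<open>Otherwise \<open>k\<close> sets can be chosen greedily: with \<open>j\<close> sets
  chosen, more than \<open>j\<close> have at least \<open>L + 1 - j\<close> elements, so a new one
  exists. It meets the earlier union in at most \<open>j\<close> elements and adds at least
  \<open>L + 1 - 2 * j\<close>. These gains sum to \<open>k * (L + 2 - k)\<close>, too many for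
  \<open>X\<close>. The threshold depends on \<open>m\<close> because each vertex will pay for
  \<open>m\<close> deleted arcs on top of \<open>card (N b)\<close>.\<close>

lemma few_large_sets:
  fixes N :: "'a \<Rightarrow> 'b set"
  assumes "finite V" and "finite X" and sub: "\<And>b. b \<in> V \<Longrightarrow> N b \<subseteq> X"
    and inter: "\<And>b b'. b \<in> V \<Longrightarrow> b' \<in> V \<Longrightarrow> b \<noteq> b' \<Longrightarrow> card (N b \<inter> N b') \<le> 1"
    and large: "int (card X) < int k * (int L + 2 - int k)"
  shows "\<exists>m<k. card {b\<in>V. L < card (N b) + m} \<le> m"
proof (rule ccontr)
  assume "\<not> ?thesis"
  hence many: "m < card {b\<in>V. L < card (N b) + m}" if "m < k" for m
    using that by force
  have "\<exists>T\<subseteq>V. card T = j \<and> int j * (int L + 2 - int j) \<le> int (card (\<Union>b\<in>T. N b))" if "j \<le> k" for j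
    using that
  proof (induction j)
    case 0
    show ?case by (intro exI[of _ "{}"]) simp
  next
    case (Suc j)
    then obtain T where T: "T \<subseteq> V" "card T = j"
      "int j * (int L + 2 - int j) \<le> int (card (\<Union>b\<in>T. N b))" by auto
    have finT: "finite T" using T assms(1) finite_subset by blast
    have "card T < card {b\<in>V. L < card (N b) + j}" using many[of j] Suc.prems T(2) by simp
    hence "\<not> {b\<in>V. L < card (N b) + j} \<subseteq> T"
      using card_mono[OF finT] by (meson not_le)
    then obtain b where b: "b \<in> V" "L < card (N b) + j" "b \<notin> T" by blast
    let ?U = "\<Union>b\<in>T. N b"
    have finU: "finite ?U" "finite (N b)"
      using T(1) sub b(1) \<open>finite X\<close> by (meson UN_least finite_subset subset_iff)+
    have "card (N b \<inter> ?U) = card (\<Union>t\<in>T. N b \<inter> N t)" by (simp only: Int_UN_distrib)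
    also have "\<dots> \<le> (\<Sum>t\<in>T. card (N b \<inter> N t))" by (rule card_UN_le[OF finT])
    also have "\<dots> \<le> (\<Sum>t\<in>T. 1)" using inter b T(1) by (intro sum_mono) blast
    finally have "card (N b \<inter> ?U) \<le> j" using T(2) by simp
    moreover have "card (N b \<union> ?U) + card (N b \<inter> ?U) = card (N b) + card ?U"
      using card_Un_Int[OF finU(2,1)] by simp
    ultimately have "int (card (\<Union>b\<in>insert b T. N b)) \<ge> int (card ?U) + int L + 1 - 2 * int j"
      using b(2) by simp
    moreover have "int (Suc j) * (int L + 2 - int (Suc j))
        = int j * (int L + 2 - int j) + int L + 1 - 2 * int j"
      by (simp add: algebra_simps)
    ultimately show ?case
      using T b finT by (intro exI[of _ "insert b T"]) auto
  qed
  from this[of k] obtain T where T: "T \<subseteq> V"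
    "int k * (int L + 2 - int k) \<le> int (card (\<Union>b\<in>T. N b))" by auto
  have "card (\<Union>b\<in>T. N b) \<le> card X"
    using T(1) sub by (intro card_mono \<open>finite X\<close>) blast
  with T(2) large show False by linarith
qed

section \<open>Reduction to monochromatic stars and their orientation\<close>

text \<open>Take \<open>H\<close> minimal under inclusion. Deleting \<open>e\<close> can only lose
  the color \<open>c e\<close>, and only at a vertex of \<open>e\<close>; by minimality this happens
  at some \<open>v\<close>, where \<open>e\<close> is then the sole edge of its color. For edges of
  size two, this excludes monochromatic triangles and paths with three edges, so the color classes
  consist of stars.\<close>

lemma minimal_color_preserving_edge_set:
  fixes E :: "'a set set"
  assumes "finite E"
  obtains H where "H \<subseteq> E" "\<And>v. c ` {e\<in>H. v \<in> e} = c ` {e\<in>E. v \<in> e}"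
    "\<And>e. e \<in> H \<Longrightarrow> \<exists>v\<in>e. \<forall>e'\<in>H. v \<in> e' \<and> c e' = c e \<longrightarrow> e' = e"
proof -
  let ?F = "{H. H \<subseteq> E \<and> (\<forall>v. c ` {e\<in>H. v \<in> e} = c ` {e\<in>E. v \<in> e})}"
  have fin: "finite ?F" using assms by simp
  have "E \<in> ?F" by simp
  hence ne: "?F \<noteq> {}" by (metis empty_iff)
  obtain H where H: "H \<in> ?F" and min: "\<forall>H'\<in>?F. H' \<subseteq> H \<longrightarrow> H = H'"
    using finite_has_minimal[OF fin ne] by (elim bexE)
  have "\<exists>v\<in>e. \<forall>e'\<in>H. v \<in> e' \<and> c e' = c e \<longrightarrow> e' = e" if "e \<in> H" for e
  proof (rule ccontr)
    assume "\<not> ?thesis"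
    hence other: "\<exists>e'\<in>H. v \<in> e' \<and> c e' = c e \<and> e' \<noteq> e" if "v \<in> e" for v
      using that by blast
    have "c ` {e'\<in>H - {e}. v \<in> e'} = c ` {e\<in>H. v \<in> e}" for v
    proof
      show "c ` {e\<in>H. v \<in> e} \<subseteq> c ` {e'\<in>H - {e}. v \<in> e'}"
      proof
        fix a assume "a \<in> c ` {e\<in>H. v \<in> e}"
        then obtain f where f: "f \<in> H" "v \<in> f" "a = c f" by blast
        show "a \<in> c ` {e'\<in>H - {e}. v \<in> e'}"
        proof (cases "f = e")
          case True
          then obtain e' where "e' \<in> H" "v \<in> e'" "c e' = c e" "e' \<noteq> e" using other f by blast
          thus ?thesis using f True by (intro image_eqI[of _ _ e']) auto
        qed (use f in auto)
      qed
    qed blast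
    hence "H - {e} \<in> ?F" using H by auto
    from mp[OF bspec[OF min this] Diff_subset] \<open>e \<in> H\<close> show False by blast
  qed
  thus thesis using that H by blast
qed

text \<open>Each edge leaves an end \<open>t e\<close> at which its color occurs only once, that is,
  a leaf of its star. Any other edge of the same color at the tail of an arc is thereby excluded,
  whether it enters or leaves there; this gives the last two conclusions.\<close>

lemma star_orientation:
  fixes E :: "'a set set"
  assumes "finite E" and pair: "\<And>e. e \<in> E \<Longrightarrow> \<exists>u v. u \<noteq> v \<and> e = {u,v}"
  obtains A where "edges_of A \<subseteq> E" "\<And>v. c ` {e\<in>edges_of A. v \<in> e} = c ` {e\<in>E. v \<in> e}"
    "\<And>u v w. (u,v) \<in> A \<Longrightarrow> (v,w) \<in> A \<Longrightarrow> c {u,v} \<noteq> c {v,w}"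
    "\<And>u v w. (u,v) \<in> A \<Longrightarrow> (u,w) \<in> A \<Longrightarrow> c {u,v} = c {u,w} \<Longrightarrow> v = w"
proof -
  obtain H where H: "H \<subseteq> E" "\<And>v. c ` {e\<in>H. v \<in> e} = c ` {e\<in>E. v \<in> e}"
    "\<And>e. e \<in> H \<Longrightarrow> \<exists>v\<in>e. \<forall>e'\<in>H. v \<in> e' \<and> c e' = c e \<longrightarrow> e' = e"
    using minimal_color_preserving_edge_set[OF assms(1), of c] by blast
  obtain t where t: "\<And>e. e \<in> H \<Longrightarrow> t e \<in> e"
    and uniq: "\<And>e e'. e \<in> H \<Longrightarrow> e' \<in> H \<Longrightarrow> t e \<in> e' \<Longrightarrow> c e' = c e \<Longrightarrow> e' = e"
    using H(3) by metis
  define A where "A = {(u,v). u \<noteq> v \<and> {u,v} \<in> H \<and> t {u,v} = u}"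
  have "edges_of A = H"
  proof
    show "edges_of A \<subseteq> H" by (auto simp: edges_of_def A_def)
    show "H \<subseteq> edges_of A"
    proof
      fix e assume e: "e \<in> H"
      then obtain u v where uv: "u \<noteq> v" "e = {u,v}" using pair H(1) by blast
      have "(u,v) \<in> A \<or> (v,u) \<in> A"
        using t[OF e] e uv by (auto simp: A_def insert_commute)
      thus "e \<in> edges_of A" using uv by (auto simp: edges_of_def insert_commute intro: rev_image_eqI)
    qed
  qed
  moreover have "c {u,v} \<noteq> c {v,w}" if "(u,v) \<in> A" "(v,w) \<in> A" for u v w
  proof
    assume "c {u,v} = c {v,w}"
    \<comment> \<open>The tail \<open>v\<close> of the second arc also lies on the first edge. The
      edges thus coincide, although \<open>t\<close> selects \<open>u\<close> for one arc and
      \<open>v\<close> for the other.\<close>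
    hence "{u,v} = {v,w}" using uniq[of "{v,w}" "{u,v}"] that by (auto simp: A_def)
    thus False using that by (auto simp: A_def doubleton_eq_iff insert_commute)
  qed
  moreover have "v = w" if "(u,v) \<in> A" "(u,w) \<in> A" "c {u,v} = c {u,w}" for u v w
    using uniq[of "{u,v}" "{u,w}"] that by (auto simp: A_def doubleton_eq_iff)
  ultimately show thesis using that[of A] H by auto
qed

section \<open>Reversing the stars at the few vertices with many of them\<close>

lemma star_reversal:
  fixes V :: "'a set" and A :: "('a \<times> 'a) set" and c :: "'a set \<Rightarrow> 'c"
  assumes "finite V" and AV: "A \<subseteq> V \<times> V"
    and path: "\<And>u v w. (u,v) \<in> A \<Longrightarrow> (v,w) \<in> A \<Longrightarrow> c {u,v} \<noteq> c {v,w}"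
    and out: "\<And>u v w. (u,v) \<in> A \<Longrightarrow> (u,w) \<in> A \<Longrightarrow> c {u,v} = c {u,w} \<Longrightarrow> v = w"
    and no_C4: "\<And>b w b' w'. distinct [b,w,b',w'] \<Longrightarrow> (w,b) \<in> A \<Longrightarrow> (w,b') \<in> A \<Longrightarrow>
      (w',b) \<in> A \<Longrightarrow> (w',b') \<in> A \<Longrightarrow> properly_colored c {{b,w},{w,b'},{b',w'},{w',b}} \<Longrightarrow> False"
    and large: "int (card V) < int k * (int L + 2 - int k)" and kL: "k \<le> Suc L"
  shows "\<exists>D. D \<subseteq> A \<union> A\<inverse> \<and>
    (\<forall>u v w. (u,v) \<in> D \<longrightarrow> (v,w) \<in> D \<longrightarrow> c {u,v} \<noteq> c {v,w}) \<and>
    (\<forall>v\<in>V. card (c ` {e\<in>edges_of A. v \<in> e}) \<le> card {w. (v,w) \<in> D} + L)"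
proof -
  \<comment> \<open>A transversal of the colors entering \<open>b\<close>: one leaf for each star
    centered at \<open>b\<close>, so \<open>card (N b)\<close> counts the colors seen at
    \<open>b\<close> only on arcs into \<open>b\<close> or on stars centered there.\<close>
  have "\<exists>U\<subseteq>{u. (u,b) \<in> A}. inj_on (\<lambda>u. c {u,b}) U \<and> (\<lambda>u. c {u,b}) ` {u. (u,b) \<in> A} = (\<lambda>u. c {u,b}) ` U" for b
    by (meson order_refl subset_image_inj)
  then obtain N where N: "\<And>b. N b \<subseteq> {u. (u,b) \<in> A}" "\<And>b. inj_on (\<lambda>u. c {u,b}) (N b)"
    "\<And>b. (\<lambda>u. c {u,b}) ` {u. (u,b) \<in> A} = (\<lambda>u. c {u,b}) ` N b" by metis
  \<comment> \<open>A loop, or a pair of opposite arcs, would yield consecutive arcs on the same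
    edge.\<close>
  have irrefl: "u \<noteq> v" if "(u,v) \<in> A" for u v
    using path that by blast
  have asym: "(v,u) \<notin> A" if "(u,v) \<in> A" for u v
    using path[of u v u] that by (auto simp: insert_commute)
  have NV: "N b \<subseteq> V" for b using N(1) AV by blast
  have finN: "finite (N b)" for b using NV assms(1) finite_subset by blast
  have "card (N b \<inter> N b') \<le> 1" if "b \<in> V" "b' \<in> V" and ne: "b \<noteq> b'" for b b'
  proof -
    have "w = w'" if "w \<in> N b \<inter> N b'" "w' \<in> N b \<inter> N b'" for w w'
    proof (rule ccontr)
      assume ww: "w \<noteq> w'"
      have arcs: "(w,b) \<in> A" "(w,b') \<in> A" "(w',b) \<in> A" "(w',b') \<in> A" using that N(1) by blast+
      have dist: "distinct [b,w,b',w']" using arcs irrefl ne ww by auto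
      \<comment> \<open>Two common leaves give a 4-cycle: its colors differ at \<open>b\<close> and
        \<open>b'\<close> because the leaves represent different stars, and at \<open>w\<close> and
        \<open>w'\<close> by \<open>out\<close>.\<close>
      have "c {w,b} \<noteq> c {w',b}" using N(2)[of b] that ww by (auto dest: inj_onD)
      moreover have "c {w,b'} \<noteq> c {w',b'}" using N(2)[of b'] that ww by (auto dest: inj_onD)
      moreover have "c {w,b} \<noteq> c {w,b'}" "c {w',b} \<noteq> c {w',b'}" using out arcs ne by blast+
      ultimately have "properly_colored c {{b,w},{w,b'},{b',w'},{w',b}}"
        using dist by (auto simp: properly_colored_def insert_commute)
      thus False using no_C4 dist arcs by blast
    qed
    thus ?thesis using finN by (simp add: card_le_Suc0_iff_eq)
  qed
  from few_large_sets[of V V N, OF assms(1,1) NV this large] obtain m where m: "m < k"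
    "card {b\<in>V. L < card (N b) + m} \<le> m" by auto
  define B where "B = {b\<in>V. L < card (N b) + m}"
  have finB: "finite B" and cardB: "card B \<le> m" using m assms(1) by (auto simp: B_def)
  define D where "D = {(u,v)\<in>A. v \<notin> B} \<union> {(b,u). b \<in> B \<and> u \<in> N b}"
  show ?thesis
  proof (intro exI[of _ D] conjI allI impI ballI)
    show "D \<subseteq> A \<union> A\<inverse>" using N(1) by (auto simp: D_def)
  next
    fix u v w assume uv: "(u,v) \<in> D" and vw: "(v,w) \<in> D"
    show "c {u,v} \<noteq> c {v,w}"
    proof
      assume eq: "c {u,v} = c {v,w}"
      \<comment> \<open>An unreversed arc ends outside \<open>B\<close>, so no reversed arc follows
        it. After a reversed arc, an unreversed one of the same color would end at \<open>u\<close>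
        by \<open>out\<close>, but \<open>u\<close> is in \<open>B\<close>; two reversed arcs form a
        path of \<open>A\<close> read backwards.\<close>
      consider "(u,v) \<in> A" "v \<notin> B" | "u \<in> B" "(v,u) \<in> A" using uv N(1) by (auto simp: D_def)
      thus False
      proof cases
        case 1
        hence "(v,w) \<in> A" using vw by (auto simp: D_def)
        thus False using path 1 eq by blast
      next
        case 2
        consider "(v,w) \<in> A" "w \<notin> B" | "(w,v) \<in> A" using vw N(1) by (auto simp: D_def)
        thus False
        proof cases
          case 1
          thus False using out[of v u w] 2 eq by (auto simp: insert_commute)
        next
          case w: 2
          thus False using path[of w v u] 2 eq by (auto simp: insert_commute)
        qed
      qed
    qed
  next
    fix v assume v: "v \<in> V"
    define S where "S = {w. (v,w) \<in> A}"
    have SV: "S \<subseteq> V" using AV by (auto simp: S_def)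
    have finS: "finite S" using SV assms(1) finite_subset by blast
    have "c ` {e\<in>edges_of A. v \<in> e} \<subseteq> (\<lambda>w. c {v,w}) ` S \<union> (\<lambda>u. c {u,v}) ` {u. (u,v) \<in> A}"
      by (auto simp: edges_of_def S_def)
    also have "\<dots> = (\<lambda>w. c {v,w}) ` S \<union> (\<lambda>u. c {u,v}) ` N v" using N(3) by simp
    finally have "card (c ` {e\<in>edges_of A. v \<in> e}) \<le> card ((\<lambda>w. c {v,w}) ` S \<union> (\<lambda>u. c {u,v}) ` N v)"
      by (intro card_mono) (auto simp: finS finN)
    also have "\<dots> \<le> card S + card (N v)"
      by (meson add_mono card_Un_le card_image_le finN finS order_trans)
    finally have deg: "card (c ` {e\<in>edges_of A. v \<in> e}) \<le> card S + card (N v)" .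
    have SB: "card S \<le> card (S - B) + m"
      using diff_card_le_card_Diff[OF finB, of S] cardB by linarith
    show "card (c ` {e\<in>edges_of A. v \<in> e}) \<le> card {w. (v,w) \<in> D} + L"
    \<comment> \<open>Every vertex loses at most \<open>m\<close> arcs into \<open>B\<close>. Inside
      \<open>B\<close> the arcs to \<open>N v\<close> make up for the incoming colors, and
      \<open>m\<close> is at most \<open>L\<close> since \<open>m < k\<close>. Outside
      \<open>B\<close> the incoming colors are lost too, but then \<open>card (N v) + m\<close> is
      at most \<open>L\<close>.\<close>
    proof (cases "v \<in> B")
      case True
      hence "{w. (v,w) \<in> D} = (S - B) \<union> N v" by (auto simp: D_def S_def)
      moreover have "(S - B) \<inter> N v = {}" using N(1)[of v] asym by (auto simp: S_def)
      ultimately have "card {w. (v,w) \<in> D} = card (S - B) + card (N v)"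
        using finS finN by (simp add: card_Un_disjoint)
      thus ?thesis using deg SB m(1) kL by linarith
    next
      case False
      hence "{w. (v,w) \<in> D} = S - B" by (auto simp: D_def S_def)
      moreover have "card (N v) + m \<le> L" using False v by (auto simp: B_def)
      ultimately show ?thesis using deg SB by simp
    qed
  qed
qed

section \<open>From directed cycles to properly colored cycles\<close>

lemma (in pre_digraph) cas_last:
  "cas u p v \<Longrightarrow> p \<noteq> [] \<Longrightarrow> head G (last p) = v"
proof (induction u p v rule: cas.induct)
  case (2 u e es v)
  thus ?case by (cases es) auto
qed simp

text \<open>The definition of \<open>cycle\<close> makes the heads of the arcs distinct. In a closed
  walk the list of tails is a rotation of the list of heads, so the tails are distinct as
  well.\<close>

lemma (in pre_digraph) cycle_arc_eqI:
  assumes "cycle p" "e \<in> set p" "e' \<in> set p"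
    and "tail G e = tail G e' \<or> head G e = head G e'"
  shows "e = e'"
proof -
  obtain u where u: "cas u p u" "distinct (tl (awalk_verts u p))" "p \<noteq> []"
    using assms(1) by (auto simp: cycle_def awalk_def)
  have heads: "distinct (map (head G) p)"
    using u(2,3) by (simp add: awalk_verts_conv'[OF u(1)])
  have "tail G (hd p) # map (head G) p = map (tail G) p @ [head G (last p)]"
    using awalk_verts_conv'[OF u(1)] awalk_verts_conv[of u p] u(3) by simp
  moreover have "tail G (hd p) = u" using u by (simp add: cas_simp)
  moreover have "head G (last p) = u"
    using cas_last u(1,3) by blast
  ultimately have "mset (map (head G) p) = mset (map (tail G) p)"
    by (metis add_mset_add_single add_right_cancel mset.simps(2) mset_append mset_single_iff_right union_mset_add_mset_right)
  hence "distinct (map (tail G) p)" using heads mset_eq_imp_distinct_iff by blast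
  thus ?thesis using heads assms(2-4) by (auto simp: distinct_map dest: inj_onD)
qed

text \<open>Distinct arcs of a directed cycle share neither tail nor head, so adjacent edges come
  from consecutive arcs, where \<open>path\<close> applies. Cycles of length 1 or 2 would repeat an
  edge on consecutive arcs and so violate \<open>path\<close>.\<close>

lemma proper_dicycle:
  fixes G :: "'a pair_pre_digraph"
  assumes D: "parcs D \<subseteq> parcs G" "pverts D \<subseteq> pverts G"
    and path: "\<And>u v w. (u,v) \<in> parcs D \<Longrightarrow> (v,w) \<in> parcs D \<Longrightarrow> c {u,v} \<noteq> c {v,w}"
    and p: "pre_digraph.cycle (with_proj D) p"
  shows "graph_cycle G p" "properly_colored c (edges_of (set p))"
proof -
  obtain u where u: "u \<in> pverts D" "set p \<subseteq> parcs D" "pcas u p u"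
      "distinct (tl (pawalk_verts u p))" "p \<noteq> []"
    using p by (auto simp: pre_digraph.cycle_def pre_digraph.awalk_def cas_with_proj_eq
        awalk_verts_with_proj_eq)
  have "pre_digraph.cycle (with_proj G) p"
    using u D by (auto simp: pre_digraph.cycle_def pre_digraph.awalk_def cas_with_proj_eq
        awalk_verts_with_proj_eq intro!: exI[of _ u])
  moreover have "3 \<le> length p"
  proof (rule ccontr)
    assume "\<not> 3 \<le> length p"
    then consider e where "p = [e]" | e f where "p = [e,f]"
      using u(5) by (cases p rule: remdups_adj.cases) (auto simp: not_le less_Suc_eq)
    thus False
    proof cases
      case 1
      thus False using u path[of u u u] by (cases e) auto
    next
      case 2
      thus False using u path[of u "fst f" u] by (cases e; cases f) (auto simp: insert_commute)
    qed
  qed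
  ultimately show "graph_cycle G p" by (simp add: graph_cycle_def)
  have same: "e = e'" if "e \<in> set p" "e' \<in> set p" "fst e = fst e' \<or> snd e = snd e'" for e e'
    using pre_digraph.cycle_arc_eqI[OF p, of e e'] that by simp
  show "properly_colored c (edges_of (set p))"
    unfolding properly_colored_def
  proof (intro ballI impI)
    fix f f' assume f: "f \<in> edges_of (set p)" "f' \<in> edges_of (set p)"
      and ne: "f \<noteq> f' \<and> f \<inter> f' \<noteq> {}"
    obtain x y where xy: "(x,y) \<in> set p" "f = {x,y}"
      using f(1) by (auto simp: edges_of_def)
    obtain x' y' where xy': "(x',y') \<in> set p" "f' = {x',y'}"
      using f(2) by (auto simp: edges_of_def)
    have "(x,y) \<noteq> (x',y')" using ne xy(2) xy'(2) by blast
    hence "x \<noteq> x'" "y \<noteq> y'" using same[OF xy(1) xy'(1)] by (metis fst_conv, metis snd_conv)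
    moreover have "{x,y} \<inter> {x',y'} \<noteq> {}" using ne xy(2) xy'(2) by metis
    ultimately have "x' = y \<or> x = y'" by blast
    moreover have "(x,y) \<in> parcs D" "(x',y') \<in> parcs D" using xy(1) xy'(1) u(2) by blast+
    ultimately show "c f \<noteq> c f'"
      unfolding xy(2) xy'(2) using path by (metis insert_commute)
  qed
qed

section \<open>The extremal function for digraphs\<close>

lemma min_out_degree_less:
  assumes "pair_digraph D" "pverts D \<noteq> {}"
  shows "min_out_degree (with_proj D) < card (pverts D)"
proof -
  interpret pair_digraph D by fact
  obtain v where v: "v \<in> pverts D" using assms(2) by blast
  have "out_degree (with_proj D) v = card (out_arcs (with_proj D) v)" by (simp add: out_degree_def)
  also have "\<dots> \<le> card (pverts D - {v})"
    by (rule card_inj_on_le[of snd])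
      (auto simp: out_arcs_def inj_on_def pair_finite_verts dest: pair_no_loops in_arcsD2)
  also have "\<dots> < card (pverts D)" using v pair_finite_verts by (intro psubset_card_mono) auto
  finally have "out_degree (with_proj D) v < card (pverts D)" .
  moreover have "min_out_degree (with_proj D) \<le> out_degree (with_proj D) v"
    unfolding min_out_degree_def using v pair_finite_verts by (intro Min_le) auto
  ultimately show ?thesis by linarith
qed

text \<open>A \<open>LEAST\<close> has its defining property once some number has it; here
  \<open>n\<close> does, vacuously, as out-degrees in a loopless digraph stay below the number of
  vertices.\<close>

lemma f_d_dicycle:
  fixes D :: "nat pair_pre_digraph"
  assumes "n > 0" "pair_digraph D" "card (pverts D) = n" "f_d n r \<le> min_out_degree (with_proj D)"
  shows "\<exists>p. pre_digraph.cycle (with_proj D) p \<and> length p \<le> r"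
proof -
  let ?P = "\<lambda>k. \<forall>D :: nat pair_pre_digraph.
     pair_digraph D \<and> card (pverts D) = n \<and> k \<le> min_out_degree (with_proj D) \<longrightarrow>
       (\<exists>p. pre_digraph.cycle (with_proj D) p \<and> length p \<le> r)"
  have "?P n"
  proof (intro allI impI)
    fix D :: "nat pair_pre_digraph"
    assume "pair_digraph D \<and> card (pverts D) = n \<and> n \<le> min_out_degree (with_proj D)"
    with min_out_degree_less[of D] \<open>n > 0\<close> have False by (cases "pverts D = {}") auto
    thus "\<exists>p. pre_digraph.cycle (with_proj D) p \<and> length p \<le> r" ..
  qed
  hence "?P (f_d n r)" unfolding f_d_def by (rule LeastI)
  thus ?thesis using assms by blast
qed

section \<open>Assembling the bound\<close>

lemma short_proper_cycle:
  fixes G :: "nat pair_pre_digraph" and c :: "nat set \<Rightarrow> 'c"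
  assumes "r \<ge> 4" "n > 0" "pair_graph G" "card (pverts G) = n"
    and large: "int n < int k * (int L + 2 - int k)" and kL: "k \<le> Suc L"
    and deg: "f_d n r + L \<le> min_color_degree G c"
  shows "\<exists>p. graph_cycle G p \<and> properly_colored c (edges_of (set p)) \<and> length p \<le> r"
proof (rule ccontr)
  assume no: "\<not> ?thesis"
  interpret pair_graph G by fact
  have symG: "(v,u) \<in> parcs G" if "(u,v) \<in> parcs G" for u v
    using pair_sym_arcs that by (auto simp: symmetric_def sym_def)
  have fin: "finite (edges_of (parcs G))" by (simp add: edges_of_def pair_finite_arcs)
  have "\<exists>u v. u \<noteq> v \<and> e = {u,v}" if "e \<in> edges_of (parcs G)" for e
    using that pair_no_loops by (fastforce simp: edges_of_def)
  note pair = this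
  obtain A where A: "edges_of A \<subseteq> edges_of (parcs G)"
    "\<And>v. c ` {e\<in>edges_of A. v \<in> e} = c ` {e\<in>edges_of (parcs G). v \<in> e}"
    "\<And>u v w. (u,v) \<in> A \<Longrightarrow> (v,w) \<in> A \<Longrightarrow> c {u,v} \<noteq> c {v,w}"
    "\<And>u v w. (u,v) \<in> A \<Longrightarrow> (u,w) \<in> A \<Longrightarrow> c {u,v} = c {u,w} \<Longrightarrow> v = w"
    using star_orientation[OF fin pair, of c] by blast
  have AG: "(u,v) \<in> parcs G \<and> (v,u) \<in> parcs G" if "(u,v) \<in> A" for u v
  proof -
    have "{u,v} \<in> edges_of (parcs G)" using A(1) that by (auto simp: edges_of_def)
    thus ?thesis using symG by (auto simp: edges_of_def doubleton_eq_iff)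
  qed
  hence AV: "A \<subseteq> pverts G \<times> pverts G" using in_arcsD1 in_arcsD2 by auto
  \<comment> \<open>This is where \<open>r\<close> being at least 4 enters: a properly colored
    4-cycle is already short enough.\<close>
  have C4: False if "distinct [b,w,b',w']" and arcs: "(w,b) \<in> A" "(w,b') \<in> A" "(w',b) \<in> A" "(w',b') \<in> A"
    and "properly_colored c {{b,w},{w,b'},{b',w'},{w',b}}" for b w b' w'
  proof -
    let ?p = "[(b,w),(w,b'),(b',w'),(w',b)]"
    have "graph_cycle G ?p"
      using that AG[OF arcs(1)] AG[OF arcs(2)] AG[OF arcs(3)] AG[OF arcs(4)]
      by (auto simp: graph_cycle_def cycle_def awalk_def dest: in_arcsD1 intro!: exI[of _ b])
    moreover have "edges_of (set ?p) = {{b,w},{w,b'},{b',w'},{w',b}}" by (simp add: edges_of_def)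
    moreover have "length ?p \<le> r" using \<open>r \<ge> 4\<close> by simp
    ultimately show False using no that(6) by metis
  qed
  have reversal: "\<exists>R. R \<subseteq> A \<union> A\<inverse> \<and>
      (\<forall>u v w. (u,v) \<in> R \<longrightarrow> (v,w) \<in> R \<longrightarrow> c {u,v} \<noteq> c {v,w}) \<and>
      (\<forall>v\<in>pverts G. card (c ` {e\<in>edges_of A. v \<in> e}) \<le> card {w. (v,w) \<in> R} + L)"
    by (rule star_reversal) (fact pair_finite_verts AV A(3,4) C4 kL large[folded assms(4)])+
  obtain R where R: "R \<subseteq> A \<union> A\<inverse>"
    "\<And>u v w. (u,v) \<in> R \<Longrightarrow> (v,w) \<in> R \<Longrightarrow> c {u,v} \<noteq> c {v,w}"
    "\<And>v. v \<in> pverts G \<Longrightarrow> card (c ` {e\<in>edges_of A. v \<in> e}) \<le> card {w. (v,w) \<in> R} + L"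
    using reversal by blast
  \<comment> \<open>All vertices of \<open>G\<close> are kept, so that \<open>f_d\<close> applies
    with the same \<open>n\<close>.\<close>
  define D where "D = \<lparr>pverts = pverts G, parcs = R\<rparr>"
  have RG: "R \<subseteq> parcs G" using R(1) AG by auto
  have RV: "R \<subseteq> pverts G \<times> pverts G" using R(1) AV by blast
  have D: "pair_digraph D"
    using RG RV pair_finite_verts finite_subset[OF RG pair_finite_arcs] pair_no_loops
    by unfold_locales (auto simp: D_def)
  have ne: "pverts G \<noteq> {}" using assms(2,4) by auto
  have "f_d n r \<le> out_degree (with_proj D) v" if v: "v \<in> pverts G" for v
  proof -
    have "min_color_degree G c \<le> color_degree G c v"
      unfolding min_color_degree_def using v pair_finite_verts by (intro Min_le) auto
    also have "\<dots> \<le> card {w. (v,w) \<in> R} + L" using R(3)[OF v] A(2) by (simp add: color_degree_def)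
    also have "out_arcs (with_proj D) v = Pair v ` {w. (v,w) \<in> R}"
      by (auto simp: out_arcs_def D_def)
    hence "card {w. (v,w) \<in> R} = out_degree (with_proj D) v"
      by (simp add: out_degree_def card_image inj_on_def)
    finally show ?thesis using deg by linarith
  qed
  hence "f_d n r \<le> min_out_degree (with_proj D)"
    unfolding min_out_degree_def using ne pair_finite_verts by (subst Min_ge_iff) (auto simp: D_def)
  with f_d_dicycle[OF assms(2) D] assms(4) obtain p
    where p: "pre_digraph.cycle (with_proj D) p" "length p \<le> r" by (auto simp: D_def)
  have "graph_cycle G p \<and> properly_colored c (edges_of (set p))"
    using proper_dicycle[of D G c p] p(1) RG R(2) by (auto simp: D_def)
  with no p(2) show False by blast
qed

theorem theorem1p1:
  fixes n r :: nat
  assumes "r \<ge> 4" and "n \<ge> r"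
  shows "real (f_c n r) \<le> real (f_d n r) + 2 * sqrt (real n) + 1"
proof -
  \<comment> \<open>\<open>L\<close> is the largest integer not exceeding
    \<open>2 * sqrt n + 1\<close>. With \<open>k\<close> less than \<open>sqrt n + 1\<close>, the
    factor \<open>L + 2 - k\<close> exceeds \<open>sqrt n\<close>, while \<open>k\<close> is at
    least \<open>sqrt n\<close>; hence the product exceeds \<open>n\<close>.\<close>
  define L where "L = nat \<lfloor>2 * sqrt (real n)\<rfloor> + 1"
  define k where "k = nat \<lceil>sqrt (real n)\<rceil>"
  have n: "n > 0" using assms by simp
  have s1: "sqrt (real n) \<ge> 1" using n by simp
  have L: "real L \<le> 2 * sqrt (real n) + 1" "2 * sqrt (real n) < real L"
    unfolding L_def using s1 by linarith+
  have k: "sqrt (real n) \<le> real k" "real k < sqrt (real n) + 1"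
    unfolding k_def using s1 by linarith+
  have kL: "k \<le> Suc L" using k L s1 by linarith
  have "real n = sqrt (real n) * sqrt (real n)" by simp
  also have "\<dots> < real k * (real L + 2 - real k)"
    using k L s1 by (intro mult_le_less_imp_less) linarith+
  finally have "real_of_int (int n) < real_of_int (int k * (int L + 2 - int k))" by simp
  hence large: "int n < int k * (int L + 2 - int k)" by (simp only: of_int_less_iff)
  have "f_c n r \<le> f_d n r + L"
    unfolding f_c_def
    by (rule Least_le) (use short_proper_cycle[OF assms(1) n _ _ large kL] in blast)
  thus ?thesis using L(1) by linarith
qed

end
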